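(* Let $\mathcal{M}_{\mathcal{A}},\mathcal{M}_{\mathcal{B}},\mathcal{M}_{\mathcal{C}}$ be mutually commuting von Neumann subalgebras of $\mathcal{B}(\mathcal{H})$ for some Hilbert space $\mathcal{H}$, and let $\tau$ be a network state on $\mathcal{M}_{\mathcal{ABC}}$. If $\mathcal{M}_{\mathcal{A}}$ and $\mathcal{M}_{\mathcal{C}}$ are abelian, then for all observables $A_0,A_1\in\mathcal{M}_{\mathcal{A}}$, $B_0,B_1\in\mathcal{M}_{\mathcal{B}}$, $C_0,C_1\in\mathcal{M}_{\mathcal{C}}$, $$\mathcal{S}_\tau=\sqrt{|I_\tau|}+\sqrt{|J_\tau|}\le 2.$$
   Context: Mutually commuting means that $\mathcal{M}_i\subset\mathcal{M}_j'$ for $i\neq j\in\{\mathcal{A},\mathcal{B},\mathcal{C}\}$, where $'$ denotes the commutant. $\mathcal{M}_{\mathcal{ABC}}=(\mathcal{M}_{\mathcal{A}}\vee\mathcal{M}_{\mathcal{B}}\vee\mathcal{M}_{\mathcal{C}})''$ is the von Neumann algebra generated by the three algebras. This is the ternary mutually-commuting von Neumann algebra model; it is a model of an entanglement swapping network when all states considered are network states. A network state is a state $\tau\in\mathcal{M}_{\mathcal{ABC}}^*$ (a positive normalized linear functional) satisfying the independence condition $\tau(AC)=\tau(A)\tau(C)$ for all $A\in\mathcal{M}_{\mathcal{A}}$, $C\in\mathcal{M}_{\mathcal{C}}$. Observables are of the form $A_x=A_{0|x}-A_{1|x}$, $B_y=B_{0|y}-B_{1|y}$, $C_z=C_{0|z}-C_{1|z}$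 with $x,y,z\in\{0,1\}$, where $\{A_{a|x}\}_{a=0,1}$, $\{B_{b|y}\}_{b=0,1}$, $\{C_{c|z}\}_{c=0,1}$ are two-outcome POVMs in $\mathcal{M}_{\mathcal{A}}$, $\mathcal{M}_{\mathcal{B}}$, $\mathcal{M}_{\mathcal{C}}$ respectively; equivalently, they are Hermitian elements of the respective algebras with $-I\le A_x,B_y,C_z\le I$. Set $$I_\tau=\tau\bigl((A_0+A_1)B_0(C_0+C_1)\bigr),\qquad J_\tau=\tau\bigl((A_0-A_1)B_1(C_0-C_1)\bigr).$$ *)

theory Defs
  imports "HOL-Analysis.Analysis"
begin

section \<open>Complex Hilbert spaces\<close>

text \<open>
  The scalar product is conjugate-linear in its first argument. Since norms are nonnegative
  and vanish only at 0, the last axiom also makes \<open>cinner\<close> positive definite; completeness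
  comes from \<^class>\<open>banach\<close>.
\<close>

class chilbert_space = banach +
  fixes cscale :: "complex \<Rightarrow> 'a \<Rightarrow> 'a"  (infixr "*\<^sub>C" 75)
    and cinner :: "'a \<Rightarrow> 'a \<Rightarrow> complex"
  assumes cscale_add_right: "c *\<^sub>C (x + y) = c *\<^sub>C x + c *\<^sub>C y"
    and cscale_add_left: "(c + d) *\<^sub>C x = c *\<^sub>C x + d *\<^sub>C x"
    and cscale_cscale: "c *\<^sub>C (d *\<^sub>C x) = (c * d) *\<^sub>C x"
    and cscale_of_real: "complex_of_real r *\<^sub>C x = r *\<^sub>R x"
    and cinner_commute: "cinner x y = cnj (cinner y x)"
    and cinner_add_right: "cinner x (y + z) = cinner x y + cinner x z"
    and cinner_cscale_right: "cinner x (c *\<^sub>C y) = c * cinner x y"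
    and norm_eq_sqrt_cinner: "norm x = sqrt (Re (cinner x x))"

instantiation complex :: chilbert_space
begin

definition cscale_complex :: "complex \<Rightarrow> complex \<Rightarrow> complex" where
  "cscale_complex c x = c * x"

definition cinner_complex :: "complex \<Rightarrow> complex \<Rightarrow> complex" where
  "cinner_complex x y = cnj x * y"

instance
  by standard
    (auto simp: cscale_complex_def cinner_complex_def algebra_simps scaleR_conv_of_real
      cmod_def power2_eq_square)

end

lemma cinner_cscale_left: "cinner (c *\<^sub>C x) y = cnj c * cinner x y"
  by (metis cinner_commute cinner_cscale_right complex_cnj_mult)

lemma norm_cscale: "norm (c *\<^sub>C x) = cmod c * norm (x :: 'a :: chilbert_space)"
proof -
  have "cinner (c *\<^sub>C x) (c *\<^sub>C x) = complex_of_real ((cmod c)\<^sup>2) * cinner x x"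
    by (simp add: cinner_cscale_left cinner_cscale_right complex_norm_square
        mult.assoc mult.left_commute del: of_real_power)
  then have "Re (cinner (c *\<^sub>C x) (c *\<^sub>C x)) = (cmod c)\<^sup>2 * Re (cinner x x)"
    by simp
  then show ?thesis
    by (simp add: norm_eq_sqrt_cinner[of x] norm_eq_sqrt_cinner[of "c *\<^sub>C x"] real_sqrt_mult)
qed

lemma bounded_linear_cscale: "bounded_linear (cscale c :: 'a :: chilbert_space \<Rightarrow> 'a)"
proof (rule bounded_linear_intro[where K = "cmod c"])
  fix x y :: 'a and r :: real
  show "c *\<^sub>C (x + y) = c *\<^sub>C x + c *\<^sub>C y"
    by (rule cscale_add_right)
  show "c *\<^sub>C (r *\<^sub>R x) = r *\<^sub>R (c *\<^sub>C x)"
    by (simp add: cscale_of_real[symmetric] cscale_cscale mult.commute)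
  show "norm (c *\<^sub>C x) \<le> norm x * cmod c"
    by (simp add: norm_cscale)
qed

section \<open>Bounded operators and von Neumann algebras\<close>

text \<open>
  \<open>'h \<Rightarrow>\<^sub>L 'h\<close> is the library type of bounded \<^emph>\<open>real\<close>-linear maps. All operators below are taken
  from the subset \<open>\<B>\<close> of its complex-linear elements, which is \<open>B(H)\<close>; in particular commutants
  are formed inside \<open>\<B>\<close>.
\<close>

definition bounded_ops :: "('h :: chilbert_space \<Rightarrow>\<^sub>L 'h) set"  ("\<B>") where
  "\<B> = {T :: 'h \<Rightarrow>\<^sub>L 'h. \<forall>c x. T (c *\<^sub>C x) = c *\<^sub>C T x}"

lift_definition cscale_op :: "complex \<Rightarrow> ('h :: chilbert_space \<Rightarrow>\<^sub>L 'h) \<Rightarrow> 'h \<Rightarrow>\<^sub>L 'h"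
  is "\<lambda>c T x. c *\<^sub>C T x"
  by (rule bounded_linear_compose[OF bounded_linear_cscale])

definition is_adjoint :: "('h :: chilbert_space \<Rightarrow>\<^sub>L 'h) \<Rightarrow> ('h \<Rightarrow>\<^sub>L 'h) \<Rightarrow> bool" where
  "is_adjoint S T \<longleftrightarrow> (\<forall>x y. cinner (S x) y = cinner x (T y))"

definition positive_op :: "('h :: chilbert_space \<Rightarrow>\<^sub>L 'h) \<Rightarrow> bool" where
  "positive_op T \<longleftrightarrow> T \<in> \<B> \<and> (\<forall>x. cinner x (T x) \<in> \<real>\<^sub>\<ge>\<^sub>0)"

definition commutant :: "('h :: chilbert_space \<Rightarrow>\<^sub>L 'h) set \<Rightarrow> ('h \<Rightarrow>\<^sub>L 'h) set" where
  "commutant M = {T \<in> \<B>. \<forall>S\<in>M. T o\<^sub>L S = S o\<^sub>L T}"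

text \<open>
  An adjoint is unique if it exists, so the second conjunct says that \<open>M\<close> contains the adjoint
  of each of its elements.
  The last one includes that \<open>M\<close> is a unital complex subalgebra of \<open>\<B>\<close>, as the commutant of
  any subset of \<open>\<B>\<close> is one.
\<close>

definition von_neumann_algebra :: "('h :: chilbert_space \<Rightarrow>\<^sub>L 'h) set \<Rightarrow> bool" where
  "von_neumann_algebra M \<longleftrightarrow>
     M \<subseteq> \<B> \<and> (\<forall>T\<in>M. \<exists>S\<in>M. is_adjoint S T) \<and> commutant (commutant M) = M"

definition abelian :: "('h :: chilbert_space \<Rightarrow>\<^sub>L 'h) set \<Rightarrow> bool" where
  "abelian M \<longleftrightarrow> (\<forall>S\<in>M. \<forall>T\<in>M. S o\<^sub>L T = T o\<^sub>L S)"

definition mutually_commuting ::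
  "('h :: chilbert_space \<Rightarrow>\<^sub>L 'h) set \<Rightarrow> ('h \<Rightarrow>\<^sub>L 'h) set \<Rightarrow> ('h \<Rightarrow>\<^sub>L 'h) set \<Rightarrow> bool" where
  "mutually_commuting MA MB MC \<longleftrightarrow>
     MA \<subseteq> commutant MB \<and> MB \<subseteq> commutant MA \<and>
     MA \<subseteq> commutant MC \<and> MC \<subseteq> commutant MA \<and>
     MB \<subseteq> commutant MC \<and> MC \<subseteq> commutant MB"

definition generated_vna ::
  "('h :: chilbert_space \<Rightarrow>\<^sub>L 'h) set \<Rightarrow> ('h \<Rightarrow>\<^sub>L 'h) set \<Rightarrow> ('h \<Rightarrow>\<^sub>L 'h) set \<Rightarrow> ('h \<Rightarrow>\<^sub>L 'h) set" where
  "generated_vna MA MB MC = commutant (commutant (MA \<union> MB \<union> MC))"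

section \<open>Network states and observables\<close>

text \<open>
  A functional on \<open>M\<close> is a function on all operators of which only the values on \<open>M\<close> matter.
  Norm continuity of a state is automatic from positivity, so it is not required separately.
\<close>

definition state_on ::
  "('h :: chilbert_space \<Rightarrow>\<^sub>L 'h) set \<Rightarrow> (('h \<Rightarrow>\<^sub>L 'h) \<Rightarrow> complex) \<Rightarrow> bool" where
  "state_on M \<tau> \<longleftrightarrow>
     (\<forall>S\<in>M. \<forall>T\<in>M. \<tau> (S + T) = \<tau> S + \<tau> T) \<and>
     (\<forall>c. \<forall>T\<in>M. \<tau> (cscale_op c T) = c * \<tau> T) \<and>
     (\<forall>T\<in>M. positive_op T \<longrightarrow> \<tau> T \<in> \<real>\<^sub>\<ge>\<^sub>0) \<and>
     \<tau> id_blinfun = 1"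

definition network_state ::
  "('h :: chilbert_space \<Rightarrow>\<^sub>L 'h) set \<Rightarrow> ('h \<Rightarrow>\<^sub>L 'h) set \<Rightarrow> ('h \<Rightarrow>\<^sub>L 'h) set \<Rightarrow>
     (('h \<Rightarrow>\<^sub>L 'h) \<Rightarrow> complex) \<Rightarrow> bool" where
  "network_state MA MB MC \<tau> \<longleftrightarrow>
     state_on (generated_vna MA MB MC) \<tau> \<and>
     (\<forall>A\<in>MA. \<forall>C\<in>MC. \<tau> (A o\<^sub>L C) = \<tau> A * \<tau> C)"

definition povm2 ::
  "('h :: chilbert_space \<Rightarrow>\<^sub>L 'h) set \<Rightarrow> ('h \<Rightarrow>\<^sub>L 'h) \<Rightarrow> ('h \<Rightarrow>\<^sub>L 'h) \<Rightarrow> bool" where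
  "povm2 M E0 E1 \<longleftrightarrow>
     E0 \<in> M \<and> E1 \<in> M \<and> positive_op E0 \<and> positive_op E1 \<and> E0 + E1 = id_blinfun"

definition observable ::
  "('h :: chilbert_space \<Rightarrow>\<^sub>L 'h) set \<Rightarrow> ('h \<Rightarrow>\<^sub>L 'h) \<Rightarrow> bool" where
  "observable M X \<longleftrightarrow> (\<exists>E0 E1. povm2 M E0 E1 \<and> X = E0 - E1)"

definition corr_I ::
  "(('h :: chilbert_space \<Rightarrow>\<^sub>L 'h) \<Rightarrow> complex) \<Rightarrow> ('h \<Rightarrow>\<^sub>L 'h) \<Rightarrow> ('h \<Rightarrow>\<^sub>L 'h) \<Rightarrow>
     ('h \<Rightarrow>\<^sub>L 'h) \<Rightarrow> ('h \<Rightarrow>\<^sub>L 'h) \<Rightarrow> ('h \<Rightarrow>\<^sub>L 'h) \<Rightarrow> complex" where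
  "corr_I \<tau> A0 A1 B0 C0 C1 = \<tau> ((A0 + A1) o\<^sub>L B0 o\<^sub>L (C0 + C1))"

definition corr_J ::
  "(('h :: chilbert_space \<Rightarrow>\<^sub>L 'h) \<Rightarrow> complex) \<Rightarrow> ('h \<Rightarrow>\<^sub>L 'h) \<Rightarrow> ('h \<Rightarrow>\<^sub>L 'h) \<Rightarrow>
     ('h \<Rightarrow>\<^sub>L 'h) \<Rightarrow> ('h \<Rightarrow>\<^sub>L 'h) \<Rightarrow> ('h \<Rightarrow>\<^sub>L 'h) \<Rightarrow> complex" where
  "corr_J \<tau> A0 A1 B1 C0 C1 = \<tau> ((A0 - A1) o\<^sub>L B1 o\<^sub>L (C0 - C1))"

end

theory Submission
  imports Defs
begin

text \<open>
  For commuting observables \<open>X\<close> and \<open>Y\<close>, that is \<open>-1 \<le> X, Y \<le> 1\<close>, the four products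
  \<open>(1 \<plusminus> X) (1 \<plusminus> Y)\<close> are positive operators. Multiplied out, this says
  \<open>\<bar>X + Y\<bar> \<le> 1 + X Y\<close> and \<open>\<bar>X - Y\<bar> \<le> 1 - X Y\<close>, where \<open>\<bar>X\<bar> \<le> P\<close> stands for \<open>-P \<le> X \<le> P\<close>
  (\<open>abs_bounded_by_add_diff\<close>). It applies to both outer parties because their algebras are
  abelian.

  Bounds of this form multiply over commuting factors (\<open>abs_bounded_by_compose\<close>), so that, with
  the same sign throughout,
  \<open>\<bar>(A\<^sub>0 \<plusminus> A\<^sub>1) B (C\<^sub>0 \<plusminus> C\<^sub>1)\<bar> \<le> (1 \<plusminus> A\<^sub>0 A\<^sub>1) (1 \<plusminus> C\<^sub>0 C\<^sub>1)\<close>. Apply \<open>\<tau>\<close> and use independence: with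
  \<open>a = \<tau> (A\<^sub>0 A\<^sub>1)\<close> and \<open>c = \<tau> (C\<^sub>0 C\<^sub>1)\<close>, which are real and lie in \<open>[-1, 1]\<close>,
  \<open>\<bar>I\<bar> \<le> (1 + a) (1 + c)\<close> and \<open>\<bar>J\<bar> \<le> (1 - a) (1 - c)\<close>. By the inequality of
  arithmetic and geometric means, \<open>\<surd>\<bar>I\<bar> + \<surd>\<bar>J\<bar>\<close> is at most
  \<open>(1 + (a + c) / 2) + (1 - (a + c) / 2) = 2\<close>.

  The one analytic ingredient is that the product of two commuting positive operators is positive
  (\<open>positive_op_compose\<close>). The proof is the classical one of F. Riesz: a contraction
  \<open>0 \<le> S \<le> 1\<close> is the strong sum of the squares of polynomials in \<open>S\<close>.
\<close>

section \<open>The scalar product and positive operators\<close>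

lemmas blinfun_compose_bilinear =
  bounded_bilinear.add_left[OF bounded_bilinear_blinfun_compose]
  bounded_bilinear.add_right[OF bounded_bilinear_blinfun_compose]
  bounded_bilinear.diff_left[OF bounded_bilinear_blinfun_compose]
  bounded_bilinear.diff_right[OF bounded_bilinear_blinfun_compose]
  bounded_bilinear.scaleR_left[OF bounded_bilinear_blinfun_compose]
  bounded_bilinear.scaleR_right[OF bounded_bilinear_blinfun_compose]

lemma blinfun_compose_id: "id_blinfun o\<^sub>L T = T" "T o\<^sub>L id_blinfun = T"
  by (simp_all add: blinfun_eqI)

lemma blinfun_compose_assoc: "(R o\<^sub>L S) o\<^sub>L T = R o\<^sub>L (S o\<^sub>L T)"
  by (rule blinfun_eqI) simp

lemma cinner_add_left: "cinner (x + y) z = cinner x z + cinner y z"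
  by (metis cinner_add_right cinner_commute complex_cnj_add)

lemma cinner_scaleR_right: "cinner x (r *\<^sub>R y) = complex_of_real r * cinner x y"
  by (metis cinner_cscale_right cscale_of_real)

lemma cinner_zero_right: "cinner x 0 = 0"
  using cinner_scaleR_right[of x 0 0] by simp

lemma cinner_minus_right: "cinner x (- y) = - cinner x y"
  using cinner_scaleR_right[of x "-1" y] by simp

lemma cinner_diff_right: "cinner x (y - z) = cinner x y - cinner x z"
  using cinner_add_right[of x y "- z"] by (simp add: cinner_minus_right)

lemma cinner_sum_right: "cinner x (\<Sum>i\<in>I. f i) = (\<Sum>i\<in>I. cinner x (f i))"
  by (induction I rule: infinite_finite_induct) (simp_all add: cinner_zero_right cinner_add_right)

lemma Im_cinner_self: "Im (cinner x x) = 0"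
  by (metis cinner_commute Im_complex_of_real complex_is_Real_iff Reals_cnj_iff)

lemma Re_cinner_self: "Re (cinner x x) = (norm x)\<^sup>2"
  by (metis norm_eq_sqrt_cinner norm_ge_zero real_sqrt_ge_0_iff real_sqrt_pow2)

text \<open>
  The triangle inequality is part of the norm axioms; squaring it gives this real form of the
  Cauchy--Schwarz inequality.
\<close>

lemma Re_cinner_le: "Re (cinner x y) \<le> norm x * norm y"
proof -
  have "Re (cinner y x) = Re (cinner x y)"
    using cinner_commute[of y x] by simp
  then have "(norm (x + y))\<^sup>2 = (norm x)\<^sup>2 + (norm y)\<^sup>2 + 2 * Re (cinner x y)"
    unfolding Re_cinner_self[symmetric] by (simp add: cinner_add_left cinner_add_right)
  moreover have "(norm (x + y))\<^sup>2 \<le> (norm x + norm y)\<^sup>2"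
    by (simp add: norm_triangle_ineq power_mono)
  ultimately show ?thesis
    by (simp add: power2_sum)
qed

lemma positive_op_iff:
  "positive_op T \<longleftrightarrow> T \<in> \<B> \<and> (\<forall>x. Im (cinner x (T x)) = 0 \<and> 0 \<le> Re (cinner x (T x)))"
  by (auto simp: positive_op_def complex_nonneg_Reals_iff)

lemma bounded_ops_id: "id_blinfun \<in> \<B>"
  by (simp add: bounded_ops_def)

lemma bounded_ops_add: "S \<in> \<B> \<Longrightarrow> T \<in> \<B> \<Longrightarrow> S + T \<in> \<B>"
  by (simp add: bounded_ops_def plus_blinfun.rep_eq cscale_add_right)

lemma bounded_ops_cscale: "T \<in> \<B> \<Longrightarrow> cscale_op c T \<in> \<B>"
  by (simp add: bounded_ops_def cscale_op.rep_eq cscale_cscale mult.commute)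

lemma bounded_ops_compose: "S \<in> \<B> \<Longrightarrow> T \<in> \<B> \<Longrightarrow> S o\<^sub>L T \<in> \<B>"
  by (simp add: bounded_ops_def)

lemma cscale_op_of_real: "cscale_op (complex_of_real r) T = r *\<^sub>R T"
  by (rule blinfun_eqI) (simp add: cscale_op.rep_eq cscale_of_real scaleR_blinfun.rep_eq)

lemma bounded_ops_scaleR: "T \<in> \<B> \<Longrightarrow> r *\<^sub>R T \<in> \<B>"
  by (metis bounded_ops_cscale cscale_op_of_real)

lemma bounded_ops_diff: "S \<in> \<B> \<Longrightarrow> T \<in> \<B> \<Longrightarrow> S - T \<in> \<B>"
  using bounded_ops_add[of S "(-1) *\<^sub>R T"] bounded_ops_scaleR[of T "-1"] by simp

lemma positive_op_add: "positive_op S \<Longrightarrow> positive_op T \<Longrightarrow> positive_op (S + T)"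
  by (simp add: positive_op_iff bounded_ops_add plus_blinfun.rep_eq cinner_add_right)

lemma positive_op_scaleR: "positive_op T \<Longrightarrow> 0 \<le> r \<Longrightarrow> positive_op (r *\<^sub>R T)"
  by (simp add: positive_op_iff bounded_ops_scaleR scaleR_blinfun.rep_eq cinner_scaleR_right)

lemma positive_op_id: "positive_op id_blinfun"
  by (simp add: positive_op_iff bounded_ops_id Im_cinner_self Re_cinner_self)

text \<open>
  Polarization: the form \<open>cinner x (S y)\<close> is Hermitian because its quadratic form is real
  at \<open>x + y\<close> and at \<open>x + \<i> y\<close>.
\<close>

lemma positive_op_symmetric:
  assumes "positive_op S"
  shows "cinner (S x) y = cinner x (S y)"
proof -
  have S: "S (c *\<^sub>C u) = c *\<^sub>C S u" for c u
    using assms by (simp add: positive_op_def bounded_ops_def)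
  have real: "Im (cinner u (S u)) = 0" for u
    using assms by (simp add: positive_op_iff)
  have "Im (cinner x (S y)) + Im (cinner y (S x)) = 0"
    using real[of "x + y"] real[of x] real[of y]
    by (simp add: blinfun.add_right cinner_add_left cinner_add_right)
  moreover have "Re (cinner x (S y)) = Re (cinner y (S x))"
    using real[of "x + \<i> *\<^sub>C y"] real[of x] real[of y]
    by (simp add: blinfun.add_right cinner_add_left cinner_add_right S
        cinner_cscale_left cinner_cscale_right)
  ultimately have "cinner x (S y) = cnj (cinner y (S x))"
    by (simp add: complex_eq_iff)
  then show ?thesis
    by (metis cinner_commute)
qed

lemma positive_op_sandwich:
  assumes "positive_op S" and "positive_op T"
  shows "positive_op (S o\<^sub>L T o\<^sub>L S)"
proof -
  have "cinner x ((S o\<^sub>L T o\<^sub>L S) x) = cinner (S x) (T (S x))" for x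
    by (simp add: positive_op_symmetric[OF assms(1)])
  then show ?thesis
    using assms by (simp add: positive_op_iff bounded_ops_compose)
qed

lemma positive_op_square:
  assumes "positive_op S"
  shows "positive_op (S o\<^sub>L S)"
  using positive_op_sandwich[OF assms positive_op_id] by (simp add: blinfun_compose_id)

section \<open>Products of commuting positive operators\<close>

text \<open>
  The remainders in Riesz's expansion of \<open>S\<close> into squares:
  \<open>S = S\<^sub>0\<^sup>2 + \<dots> + S\<^sub>n\<^sub>-\<^sub>1\<^sup>2 + S\<^sub>n\<close>, where \<open>S\<^sub>n\<close> is \<open>riesz S n\<close>.
\<close>

primrec riesz :: "('h :: chilbert_space \<Rightarrow>\<^sub>L 'h) \<Rightarrow> nat \<Rightarrow> 'h \<Rightarrow>\<^sub>L 'h" where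
  "riesz S 0 = S"
| "riesz S (Suc n) = riesz S n - (riesz S n o\<^sub>L riesz S n)"

lemma riesz_commute:
  assumes "S o\<^sub>L T = T o\<^sub>L S"
  shows "riesz S n o\<^sub>L T = T o\<^sub>L riesz S n"
proof (induction n)
  case 0
  then show ?case using assms by simp
next
  case (Suc n)
  have comm: "riesz S n (T x) = T (riesz S n x)" for x
    using Suc by (metis blinfun_apply_blinfun_compose)
  show ?case
    by (rule blinfun_eqI) (simp add: minus_blinfun.rep_eq blinfun.diff_right comm)
qed

text \<open>
  If \<open>R\<close> is a positive contraction then so is \<open>R - R\<^sup>2\<close>, since
  \<open>R - R\<^sup>2 = R (1 - R) R + (1 - R) R (1 - R)\<close> and \<open>1 - (R - R\<^sup>2) = (1 - R) + R\<^sup>2\<close>.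
\<close>

lemma riesz_positive:
  assumes "positive_op S" and "positive_op (id_blinfun - S)"
  shows "positive_op (riesz S n) \<and> positive_op (id_blinfun - riesz S n)"
proof (induction n)
  case 0
  then show ?case using assms by simp
next
  case (Suc n)
  let ?R = "riesz S n" and ?Q = "id_blinfun - riesz S n"
  have "riesz S (Suc n) = (?R o\<^sub>L ?Q o\<^sub>L ?R) + (?Q o\<^sub>L ?R o\<^sub>L ?Q)"
    by (rule blinfun_eqI)
      (simp add: minus_blinfun.rep_eq plus_blinfun.rep_eq blinfun.diff_right)
  moreover have "id_blinfun - riesz S (Suc n) = ?Q + (?R o\<^sub>L ?R)"
    by simp
  ultimately show ?case
    using Suc by (metis positive_op_add positive_op_sandwich positive_op_square)
qed

lemma riesz_sum_squares:
  fixes S :: "'h :: chilbert_space \<Rightarrow>\<^sub>L 'h"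
  shows "S x = (\<Sum>k<n. riesz S k (riesz S k x)) + riesz S n x"
  by (induction n) (simp_all add: minus_blinfun.rep_eq)

text \<open>
  The expansion converges strongly: pairing it with \<open>x\<close> bounds the sum of all
  \<open>\<parallel>S\<^sub>n x\<parallel>\<^sup>2\<close> by \<open>cinner x (S x)\<close>.
\<close>

lemma riesz_tendsto_zero:
  assumes "positive_op S" and "positive_op (id_blinfun - S)"
  shows "(\<lambda>n. norm (riesz S n x)) \<longlonglongrightarrow> 0"
proof -
  have pos: "positive_op (riesz S n)" for n
    using riesz_positive[OF assms] by blast
  have sq: "Re (cinner x (riesz S k (riesz S k x))) = (norm (riesz S k x))\<^sup>2" for k
    using positive_op_symmetric[OF pos[of k], of x "riesz S k x"]
    by (metis Re_cinner_self)
  have "(\<Sum>k<n. (norm (riesz S k x))\<^sup>2) \<le> Re (cinner x (S x))" for n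
  proof -
    have "Re (cinner x (S x)) = (\<Sum>k<n. (norm (riesz S k x))\<^sup>2) + Re (cinner x (riesz S n x))"
      by (subst riesz_sum_squares[of S x n]) (simp add: cinner_add_right cinner_sum_right sq)
    then show ?thesis
      using pos[of n] by (simp add: positive_op_iff)
  qed
  then have "summable (\<lambda>k. (norm (riesz S k x))\<^sup>2)"
    by (intro summableI_nonneg_bounded) auto
  then have "(\<lambda>k. sqrt ((norm (riesz S k x))\<^sup>2)) \<longlonglongrightarrow> sqrt 0"
    by (intro tendsto_real_sqrt summable_LIMSEQ_zero)
  then show ?thesis
    by simp
qed

text \<open>
  When \<open>S \<le> 1\<close>, the squares in Riesz's expansion contribute \<open>T S\<^sub>k\<^sup>2 = S\<^sub>k T S\<^sub>k \<ge> 0\<close> to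
  \<open>T S\<close>, and the remainder \<open>T S\<^sub>n\<close> vanishes in the limit.
\<close>

lemma positive_op_compose_contraction:
  assumes S: "positive_op S" "positive_op (id_blinfun - S)" and T: "positive_op T"
    and comm: "S o\<^sub>L T = T o\<^sub>L S"
  shows "positive_op (S o\<^sub>L T)"
proof -
  have comm': "S (T x) = T (S x)" for x
    using comm by (metis blinfun_apply_blinfun_compose)
  have "Im (cinner x (T (S x))) = 0" for x
  proof -
    have "cinner x (T (S x)) = cinner (T (S x)) x"
      by (metis comm' positive_op_symmetric[OF S(1)] positive_op_symmetric[OF T])
    then have "cinner x (T (S x)) = cnj (cinner x (T (S x)))"
      by (metis cinner_commute)
    then show ?thesis
      by (simp add: complex_eq_iff)
  qed
  moreover have "0 \<le> Re (cinner x (T (S x)))" for x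
  proof -
    have "- (norm (T x) * norm (riesz S n x)) \<le> Re (cinner x (T (S x)))" for n
    proof -
      have summand: "0 \<le> Re (cinner x (T (riesz S k (riesz S k x))))" for k
      proof -
        have "T (riesz S k u) = riesz S k (T u)" for u
          using riesz_commute[OF comm, of k] by (metis blinfun_apply_blinfun_compose)
        then have "cinner x (T (riesz S k (riesz S k x)))
            = cinner (riesz S k x) (T (riesz S k x))"
          using positive_op_symmetric[of "riesz S k"] riesz_positive[OF S] by metis
        then show ?thesis
          using T by (simp add: positive_op_iff)
      qed
      have "T (S x) = (\<Sum>k<n. T (riesz S k (riesz S k x))) + T (riesz S n x)"
        by (subst riesz_sum_squares[of S x n]) (simp add: blinfun.add_right blinfun.sum_right)
      then have "Re (cinner x (T (S x)))
          = (\<Sum>k<n. Re (cinner x (T (riesz S k (riesz S k x)))))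
            + Re (cinner x (T (riesz S n x)))"
        by (simp add: cinner_add_right cinner_sum_right)
      then have "Re (cinner x (T (riesz S n x))) \<le> Re (cinner x (T (S x)))"
        by (simp add: sum_nonneg summand)
      moreover have "- Re (cinner x (T (riesz S n x))) \<le> norm (T x) * norm (riesz S n x)"
        using Re_cinner_le[of "T x" "- riesz S n x"]
        by (simp add: cinner_minus_right positive_op_symmetric[OF T])
      ultimately show ?thesis
        by linarith
    qed
    moreover have "(\<lambda>n. - (norm (T x) * norm (riesz S n x))) \<longlonglongrightarrow> 0"
      using tendsto_minus[OF tendsto_mult_left[OF riesz_tendsto_zero[OF S]]] by simp
    ultimately show ?thesis
      by (intro LIMSEQ_le_const2) auto
  qed
  ultimately show ?thesis
    using S(1) T comm by (simp add: positive_op_iff bounded_ops_compose)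
qed

lemma positive_op_compose:
  assumes S: "positive_op S" and T: "positive_op T" and comm: "S o\<^sub>L T = T o\<^sub>L S"
  shows "positive_op (S o\<^sub>L T)"
proof -
  (* Rescale S to a contraction; adding 1 keeps the factor nonzero when S = 0. *)
  define r where "r = norm S + 1"
  have r: "r > 0" and "norm S \<le> r"
    by (simp_all add: r_def add_nonneg_pos)
  have contraction: "positive_op (id_blinfun - (1 / r) *\<^sub>R S)"
  proof -
    have "Re (cinner x (S x)) \<le> r * (norm x)\<^sup>2" for x
    proof -
      have "Re (cinner x (S x)) \<le> norm x * norm (S x)"
        by (rule Re_cinner_le)
      also have "\<dots> \<le> norm x * (r * norm x)"
        using norm_blinfun[of S x] \<open>norm S \<le> r\<close>
        by (intro mult_left_mono) (auto intro: order_trans[OF _ mult_right_mono])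
      finally show ?thesis
        by (simp add: power2_eq_square mult_ac)
    qed
    then have "Re (cinner x (S x)) / r \<le> (norm x)\<^sup>2" for x
      using r by (simp add: divide_le_eq mult.commute)
    then show ?thesis
      using S by (simp add: positive_op_iff bounded_ops_diff bounded_ops_id bounded_ops_scaleR
          minus_blinfun.rep_eq scaleR_blinfun.rep_eq cinner_diff_right cinner_scaleR_right
          Im_cinner_self Re_cinner_self)
  qed
  have comm': "(1 / r) *\<^sub>R S o\<^sub>L T = T o\<^sub>L (1 / r) *\<^sub>R S"
    by (simp add: blinfun_compose_bilinear comm)
  have "positive_op ((1 / r) *\<^sub>R S o\<^sub>L T)"
    using S r by (intro positive_op_compose_contraction contraction T comm' positive_op_scaleR) auto
  from positive_op_scaleR[OF this, of r] show ?thesis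
    using r by (simp add: blinfun_compose_bilinear)
qed

section \<open>Commutants and bounds on absolute values\<close>

text \<open>
  The order interval \<open>-P \<le> X \<le> P\<close>. It takes the place of \<open>\<bar>X\<bar> \<le> P\<close> with the operator absolute value,
  which it is equivalent to when \<open>X\<close> and \<open>P\<close> commute.
\<close>

definition abs_bounded_by ::
    "('h :: chilbert_space \<Rightarrow>\<^sub>L 'h) \<Rightarrow> ('h \<Rightarrow>\<^sub>L 'h) \<Rightarrow> bool" where
  "abs_bounded_by X P \<longleftrightarrow> positive_op (P + X) \<and> positive_op (P - X)"

lemma commutant_commute: "T \<in> commutant M \<Longrightarrow> S \<in> M \<Longrightarrow> T o\<^sub>L S = S o\<^sub>L T"
  by (simp add: commutant_def)

lemma commutant_id: "id_blinfun \<in> commutant M"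
  by (simp add: commutant_def bounded_ops_id blinfun_compose_id)

lemma commutant_add: "S \<in> commutant M \<Longrightarrow> T \<in> commutant M \<Longrightarrow> S + T \<in> commutant M"
  by (simp add: commutant_def bounded_ops_add blinfun_compose_bilinear)

lemma commutant_cscale:
  assumes "T \<in> commutant M" and "M \<subseteq> \<B>"
  shows "cscale_op c T \<in> commutant M"
proof -
  have "cscale_op c T o\<^sub>L S = S o\<^sub>L cscale_op c T" if "S \<in> M" for S
  proof (rule blinfun_eqI)
    fix x
    have "T (S x) = S (T x)"
      using commutant_commute[OF assms(1) that] by (metis blinfun_apply_blinfun_compose)
    then show "(cscale_op c T o\<^sub>L S) x = (S o\<^sub>L cscale_op c T) x"
      using that assms(2) by (auto simp: cscale_op.rep_eq bounded_ops_def)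
  qed
  then show ?thesis
    using assms by (simp add: commutant_def bounded_ops_cscale)
qed

lemma commutant_diff:
  assumes "S \<in> commutant M" and "T \<in> commutant M"
  shows "S - T \<in> commutant M"
  using assms by (simp add: commutant_def bounded_ops_diff blinfun_compose_bilinear)

lemma commutant_compose:
  assumes "S \<in> commutant M" and "T \<in> commutant M"
  shows "S o\<^sub>L T \<in> commutant M"
  using assms unfolding commutant_def
  by (auto simp: bounded_ops_compose) (metis blinfun_compose_assoc)

lemmas commutant_intros =
  commutant_id commutant_add commutant_diff commutant_compose

text \<open>
  Twice \<open>P Q \<plusminus> X Y\<close> is the sum \<open>(P + X) (Q \<plusminus> Y) + (P - X) (Q \<mp> Y)\<close> of products of commuting
  positive operators.
\<close>

lemma abs_bounded_by_compose:
  assumes "abs_bounded_by X P" and "abs_bounded_by Y Q"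
    and "X \<in> commutant {Y, Q}" and "P \<in> commutant {Y, Q}"
  shows "abs_bounded_by (X o\<^sub>L Y) (P o\<^sub>L Q)"
proof -
  have comm: "Z (Y x) = Y (Z x)" "Z (Q x) = Q (Z x)" if "Z \<in> commutant {Y, Q}" for Z x
    using commutant_commute[OF that] by (metis blinfun_apply_blinfun_compose insertI1 insertI2)+
  have pos: "positive_op (U o\<^sub>L V)"
    if "positive_op U" "positive_op V" "U \<in> {P + X, P - X}" "V \<in> {Q + Y, Q - Y}" for U V
  proof (rule positive_op_compose[OF that(1,2)])
    show "U o\<^sub>L V = V o\<^sub>L U"
      using that(3,4) by (auto intro!: blinfun_eqI simp: plus_blinfun.rep_eq minus_blinfun.rep_eq
          blinfun.add_right blinfun.diff_right comm[OF assms(3)] comm[OF assms(4)])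
  qed
  have half: "positive_op T" if "positive_op (2 *\<^sub>R T)" for T :: "'a \<Rightarrow>\<^sub>L 'a"
    using positive_op_scaleR[OF that, of "1/2"] by simp
  have "2 *\<^sub>R ((P o\<^sub>L Q) + (X o\<^sub>L Y))
      = ((P + X) o\<^sub>L (Q + Y)) + ((P - X) o\<^sub>L (Q - Y))"
    by (rule blinfun_eqI) (simp add: plus_blinfun.rep_eq minus_blinfun.rep_eq
          scaleR_blinfun.rep_eq blinfun.add_right blinfun.diff_right scaleR_2)
  moreover have "2 *\<^sub>R ((P o\<^sub>L Q) - (X o\<^sub>L Y))
      = ((P + X) o\<^sub>L (Q - Y)) + ((P - X) o\<^sub>L (Q + Y))"
    by (rule blinfun_eqI) (simp add: plus_blinfun.rep_eq minus_blinfun.rep_eq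
          scaleR_blinfun.rep_eq blinfun.add_right blinfun.diff_right scaleR_2)
  ultimately have "positive_op (2 *\<^sub>R ((P o\<^sub>L Q) + (X o\<^sub>L Y)))"
      "positive_op (2 *\<^sub>R ((P o\<^sub>L Q) - (X o\<^sub>L Y)))"
    using assms(1,2) unfolding abs_bounded_by_def by (auto intro!: positive_op_add pos)
  from this[THEN half] show ?thesis
    unfolding abs_bounded_by_def by (rule conjI)
qed

lemma abs_bounded_by_observable:
  assumes "observable M X"
  shows "abs_bounded_by X id_blinfun"
proof -
  obtain E0 E1 where E: "positive_op E0" "positive_op E1" "E0 + E1 = id_blinfun" "X = E0 - E1"
    using assms by (auto simp: observable_def povm2_def)
  have "id_blinfun + X = 2 *\<^sub>R E0" "id_blinfun - X = 2 *\<^sub>R E1"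
    by (simp_all add: E(3)[symmetric] E(4) scaleR_2)
  then show ?thesis
    using E by (simp add: abs_bounded_by_def positive_op_scaleR)
qed

text \<open>
  With \<open>\<bar>X\<bar>, \<bar>Y\<bar> \<le> 1\<close>, the operators \<open>(1 + X Y) \<plusminus> (X + Y)\<close> factor as \<open>(1 \<plusminus> X) (1 \<plusminus> Y)\<close>, and
  \<open>(1 - X Y) \<plusminus> (X - Y)\<close> as \<open>(1 \<plusminus> X) (1 \<mp> Y)\<close>.
\<close>

lemma abs_bounded_by_add_diff:
  assumes "abs_bounded_by X id_blinfun" and "abs_bounded_by Y id_blinfun"
    and comm: "X o\<^sub>L Y = Y o\<^sub>L X"
  shows "abs_bounded_by (X + Y) (id_blinfun + (X o\<^sub>L Y))"
    and "abs_bounded_by (X - Y) (id_blinfun - (X o\<^sub>L Y))"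
proof -
  have comm': "X (Y x) = Y (X x)" for x
    using comm by (metis blinfun_apply_blinfun_compose)
  have pos: "positive_op (U o\<^sub>L V)"
    if "positive_op U" "positive_op V"
      "U \<in> {id_blinfun + X, id_blinfun - X}" "V \<in> {id_blinfun + Y, id_blinfun - Y}" for U V
  proof (rule positive_op_compose[OF that(1,2)])
    show "U o\<^sub>L V = V o\<^sub>L U"
      using that(3,4) by (auto intro!: blinfun_eqI simp: plus_blinfun.rep_eq minus_blinfun.rep_eq
          blinfun.add_right blinfun.diff_right comm')
  qed
  let ?I = "id_blinfun :: 'a \<Rightarrow>\<^sub>L 'a"
  have factor:
    "(?I + (X o\<^sub>L Y)) + (X + Y) = (?I + X) o\<^sub>L (?I + Y)"
    "(?I + (X o\<^sub>L Y)) - (X + Y) = (?I - X) o\<^sub>L (?I - Y)"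
    "(?I - (X o\<^sub>L Y)) + (X - Y) = (?I + X) o\<^sub>L (?I - Y)"
    "(?I - (X o\<^sub>L Y)) - (X - Y) = (?I - X) o\<^sub>L (?I + Y)"
    by (rule blinfun_eqI, simp add: plus_blinfun.rep_eq minus_blinfun.rep_eq
        blinfun.add_right blinfun.diff_right)+
  show "abs_bounded_by (X + Y) (?I + (X o\<^sub>L Y))" "abs_bounded_by (X - Y) (?I - (X o\<^sub>L Y))"
    using assms(1,2) unfolding abs_bounded_by_def factor by (auto intro!: pos)
qed

section \<open>Network states\<close>

lemma subset_double_commutant: "M \<subseteq> \<B> \<Longrightarrow> M \<subseteq> commutant (commutant M)"
  by (auto simp: commutant_def)

lemma state_on_diff:
  assumes "state_on M \<tau>" and "S \<in> M" and "T \<in> M" and "cscale_op (- 1) T \<in> M"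
  shows "\<tau> (S - T) = \<tau> S - \<tau> T"
proof -
  have diff: "S - T = S + cscale_op (- 1) T"
    using cscale_op_of_real[of "-1" T] by simp
  have "\<tau> (S - T) = \<tau> S + \<tau> (cscale_op (- 1) T)"
    unfolding diff using assms(1,2,4) by (simp add: state_on_def)
  also have "\<tau> (cscale_op (- 1) T) = - \<tau> T"
    using assms(1,3) by (simp add: state_on_def)
  finally show ?thesis
    by simp
qed

text \<open>
  Both \<open>\<tau> P + \<tau> X\<close> and \<open>\<tau> P - \<tau> X\<close> are nonnegative reals, so \<open>\<tau> P\<close> and \<open>\<tau> X\<close> are real.
\<close>

lemma state_on_abs_bounded_by:
  assumes \<tau>: "state_on (commutant N) \<tau>" and "N \<subseteq> \<B>"
    and M: "X \<in> commutant N" "P \<in> commutant N" and "abs_bounded_by X P"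
  shows "Im (\<tau> P) = 0" and "cmod (\<tau> X) \<le> Re (\<tau> P)"
proof -
  have "\<tau> (P + X) \<in> \<real>\<^sub>\<ge>\<^sub>0" "\<tau> (P - X) \<in> \<real>\<^sub>\<ge>\<^sub>0"
    using assms by (auto simp: state_on_def abs_bounded_by_def commutant_intros)
  moreover have "\<tau> (P + X) = \<tau> P + \<tau> X"
    using \<tau> M by (simp add: state_on_def)
  moreover have "\<tau> (P - X) = \<tau> P - \<tau> X"
    using \<open>N \<subseteq> \<B>\<close> by (intro state_on_diff[OF \<tau>] M commutant_cscale)
  ultimately have pos: "0 \<le> Re (\<tau> P) + Re (\<tau> X)" "0 \<le> Re (\<tau> P) - Re (\<tau> X)"
    and im: "Im (\<tau> P) + Im (\<tau> X) = 0" "Im (\<tau> P) - Im (\<tau> X) = 0"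
    by (auto simp: complex_nonneg_Reals_iff)
  show "Im (\<tau> P) = 0"
    using im by linarith
  have "Im (\<tau> X) = 0"
    using im by linarith
  then show "cmod (\<tau> X) \<le> Re (\<tau> P)"
    using pos by (simp add: cmod_eq_Re abs_le_iff)
qed

text \<open>
  Independence factorizes the expectation of the bound on a triple product; the middle party
  contributes only the factor \<open>1\<close>.
\<close>

lemma network_state_triple_bound:
  assumes vna: "von_neumann_algebra MA" "von_neumann_algebra MB" "von_neumann_algebra MC"
    and comm: "mutually_commuting MA MB MC"
    and net: "network_state MA MB MC \<tau>"
    and X: "X \<in> MA" "P \<in> MA" "abs_bounded_by X P"
    and Y: "Y \<in> MB" "abs_bounded_by Y id_blinfun"
    and Z: "Z \<in> MC" "Q \<in> MC" "abs_bounded_by Z Q"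
  shows "0 \<le> Re (\<tau> P)" and "0 \<le> Re (\<tau> Q)"
    and "cmod (\<tau> (X o\<^sub>L Y o\<^sub>L Z)) \<le> Re (\<tau> P) * Re (\<tau> Q)"
proof -
  let ?N = "commutant (MA \<union> MB \<union> MC)"
  have N: "?N \<subseteq> \<B>" and \<tau>: "state_on (commutant ?N) \<tau>"
    using net by (auto simp: commutant_def network_state_def generated_vna_def)
  have "MA \<union> MB \<union> MC \<subseteq> commutant ?N"
    using vna by (intro subset_double_commutant) (auto simp: von_neumann_algebra_def)
  then have gen: "X \<in> commutant ?N" "P \<in> commutant ?N" "Y \<in> commutant ?N"
      "Z \<in> commutant ?N" "Q \<in> commutant ?N"
    using X(1,2) Y(1) Z(1,2) by auto
  note boundA = state_on_abs_bounded_by[OF \<tau> N gen(1,2) X(3)]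
  note boundC = state_on_abs_bounded_by[OF \<tau> N gen(4,5) Z(3)]
  have im: "Im (\<tau> P) = 0" "Im (\<tau> Q) = 0"
    by (rule boundA boundC)+
  show "0 \<le> Re (\<tau> P)" "0 \<le> Re (\<tau> Q)"
    using boundA(2) boundC(2) norm_ge_zero order_trans by blast+
  have "X \<in> commutant {Y, id_blinfun}" "P \<in> commutant {Y, id_blinfun}"
    using comm X(1,2) Y(1)
    by (auto simp: mutually_commuting_def commutant_def blinfun_compose_id)
  from abs_bounded_by_compose[OF X(3) Y(2) this]
  have XY: "abs_bounded_by (X o\<^sub>L Y) P"
    by (simp add: blinfun_compose_id)
  have "X \<in> commutant {Z, Q}" "Y \<in> commutant {Z, Q}" "P \<in> commutant {Z, Q}"
    using comm X(1,2) Y(1) Z(1,2) by (auto simp: mutually_commuting_def commutant_def)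
  then have "abs_bounded_by (X o\<^sub>L Y o\<^sub>L Z) (P o\<^sub>L Q)"
    by (intro abs_bounded_by_compose XY Z(3) commutant_compose)
  then have "cmod (\<tau> (X o\<^sub>L Y o\<^sub>L Z)) \<le> Re (\<tau> (P o\<^sub>L Q))"
    by (intro state_on_abs_bounded_by(2)[OF \<tau> N] commutant_compose gen)
  also have "\<tau> (P o\<^sub>L Q) = \<tau> P * \<tau> Q"
    using net X(2) Z(2) by (simp add: network_state_def)
  finally show "cmod (\<tau> (X o\<^sub>L Y o\<^sub>L Z)) \<le> Re (\<tau> P) * Re (\<tau> Q)"
    using im by simp
qed

lemma von_neumann_algebra_closed:
  assumes "von_neumann_algebra M"
  shows "id_blinfun \<in> M"
    and "S \<in> M \<Longrightarrow> T \<in> M \<Longrightarrow> S + T \<in> M"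
    and "S \<in> M \<Longrightarrow> T \<in> M \<Longrightarrow> S - T \<in> M"
    and "S \<in> M \<Longrightarrow> T \<in> M \<Longrightarrow> S o\<^sub>L T \<in> M"
proof -
  have M: "commutant (commutant M) = M"
    using assms by (simp add: von_neumann_algebra_def)
  note closed = commutant_intros[where M = "commutant M", unfolded M]
  show "id_blinfun \<in> M"
    by (rule closed(1))
  show "S + T \<in> M" if "S \<in> M" "T \<in> M"
    using that by (rule closed(2))
  show "S - T \<in> M" if "S \<in> M" "T \<in> M"
    using that by (rule closed(3))
  show "S o\<^sub>L T \<in> M" if "S \<in> M" "T \<in> M"
    using that by (rule closed(4))
qed

lemma observable_in:
  assumes "von_neumann_algebra M" and "observable M X"
  shows "X \<in> M"
  using assms von_neumann_algebra_closed(3)[OF assms(1)]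
  by (auto simp: observable_def povm2_def)

theorem theorem3p2:
  fixes MA MB MC :: "('h :: chilbert_space \<Rightarrow>\<^sub>L 'h) set"
    and \<tau> :: "('h \<Rightarrow>\<^sub>L 'h) \<Rightarrow> complex"
    and A0 A1 B0 B1 C0 C1 :: "'h \<Rightarrow>\<^sub>L 'h"
  assumes "von_neumann_algebra MA" and "von_neumann_algebra MB" and "von_neumann_algebra MC"
    and "mutually_commuting MA MB MC"
    and "network_state MA MB MC \<tau>"
    and "abelian MA" and "abelian MC"
    and "observable MA A0" and "observable MA A1"
    and "observable MB B0" and "observable MB B1"
    and "observable MC C0" and "observable MC C1"
  shows "sqrt (cmod (corr_I \<tau> A0 A1 B0 C0 C1)) + sqrt (cmod (corr_J \<tau> A0 A1 B1 C0 C1)) \<le> 2"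
proof -
  let ?I = "id_blinfun :: 'h \<Rightarrow>\<^sub>L 'h"
  have mem: "A0 \<in> MA" "A1 \<in> MA" "B0 \<in> MB" "B1 \<in> MB" "C0 \<in> MC" "C1 \<in> MC"
    by (rule observable_in, fact, fact)+
  note closedA = von_neumann_algebra_closed[OF assms(1)]
  note closedC = von_neumann_algebra_closed[OF assms(3)]
  have comm: "A0 o\<^sub>L A1 = A1 o\<^sub>L A0" "C0 o\<^sub>L C1 = C1 o\<^sub>L C0"
    using assms(6,7) mem by (auto simp: abelian_def)
  note obs = assms(8-13)[THEN abs_bounded_by_observable]
  note boundsA = abs_bounded_by_add_diff[OF obs(1,2) comm(1)]
    and boundsC = abs_bounded_by_add_diff[OF obs(5,6) comm(2)]

  have \<tau>: "state_on (commutant (commutant (MA \<union> MB \<union> MC))) \<tau>"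
    using assms(5) by (simp add: network_state_def generated_vna_def)
  have "MA \<union> MB \<union> MC \<subseteq> commutant (commutant (MA \<union> MB \<union> MC))"
    using assms(1-3) by (intro subset_double_commutant) (auto simp: von_neumann_algebra_def)
  then have gen: "A0 o\<^sub>L A1 \<in> commutant (commutant (MA \<union> MB \<union> MC))"
      "C0 o\<^sub>L C1 \<in> commutant (commutant (MA \<union> MB \<union> MC))"
    using closedA(4)[OF mem(1,2)] closedC(4)[OF mem(5,6)] by auto
  have shifted: "\<tau> (?I + T) = 1 + \<tau> T" "\<tau> (?I - T) = 1 - \<tau> T"
    if "T \<in> commutant (commutant (MA \<union> MB \<union> MC))" for T
  proof -
    have one: "\<tau> ?I = 1"
      using \<tau> by (simp add: state_on_def)
    show "\<tau> (?I + T) = 1 + \<tau> T"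
      using \<tau> that one commutant_id[of "commutant (MA \<union> MB \<union> MC)"] by (simp add: state_on_def)
    have "cscale_op (- 1) T \<in> commutant (commutant (MA \<union> MB \<union> MC))"
      using that by (rule commutant_cscale) (auto simp: commutant_def)
    then show "\<tau> (?I - T) = 1 - \<tau> T"
      using state_on_diff[OF \<tau> commutant_id that] one by simp
  qed

  define a where "a = Re (\<tau> (A0 o\<^sub>L A1))"
  define c where "c = Re (\<tau> (C0 o\<^sub>L C1))"
  have a: "Re (\<tau> (?I + (A0 o\<^sub>L A1))) = 1 + a" "Re (\<tau> (?I - (A0 o\<^sub>L A1))) = 1 - a"
    and c: "Re (\<tau> (?I + (C0 o\<^sub>L C1))) = 1 + c" "Re (\<tau> (?I - (C0 o\<^sub>L C1))) = 1 - c"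
    using shifted gen by (simp_all add: a_def c_def)

  have memI: "A0 + A1 \<in> MA" "?I + (A0 o\<^sub>L A1) \<in> MA" "C0 + C1 \<in> MC" "?I + (C0 o\<^sub>L C1) \<in> MC"
    and memJ: "A0 - A1 \<in> MA" "?I - (A0 o\<^sub>L A1) \<in> MA" "C0 - C1 \<in> MC" "?I - (C0 o\<^sub>L C1) \<in> MC"
    by (intro closedA closedC mem)+
  note I = network_state_triple_bound[OF assms(1-5) memI(1,2) boundsA(1) mem(3)
      obs(3) memI(3,4) boundsC(1), unfolded a c]
  note J = network_state_triple_bound[OF assms(1-5) memJ(1,2) boundsA(2) mem(4)
      obs(4) memJ(3,4) boundsC(2), unfolded a c]

  have "sqrt (cmod (corr_I \<tau> A0 A1 B0 C0 C1)) \<le> sqrt ((1 + a) * (1 + c))"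
    using I(3) by (simp add: corr_I_def)
  also have "\<dots> \<le> ((1 + a) + (1 + c)) / 2"
    by (rule arith_geo_mean_sqrt[OF I(1,2)])
  finally have boundI: "sqrt (cmod (corr_I \<tau> A0 A1 B0 C0 C1)) \<le> ((1 + a) + (1 + c)) / 2" .
  have "sqrt (cmod (corr_J \<tau> A0 A1 B1 C0 C1)) \<le> sqrt ((1 - a) * (1 - c))"
    using J(3) by (simp add: corr_J_def)
  also have "\<dots> \<le> ((1 - a) + (1 - c)) / 2"
    by (rule arith_geo_mean_sqrt[OF J(1,2)])
  finally show ?thesis
    using boundI by (simp add: field_simps)
qed

end
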